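(* Let $(x^k,y^k,\bar y^k,\lambda^k,\bar\lambda^k)$ be the iterates of the algorithm EGADM (defined in the context) applied to the problem $$\min_{x\in\mathcal X,\ y\in\mathcal Y}\ f(x)+g(y)\quad\text{s.t.}\quad Ax+By=b .$$ For any integer $N>0$ define $$\tilde x^N:=\frac1{N+1}\sum_{k=0}^N x^{k+1},\qquad \tilde y^N:=\frac1{N+1}\sum_{k=0}^N \bar y^{k+1},\qquad \tilde\lambda^N:=\frac1{N+1}\sum_{k=0}^N\bar\lambda^{k+1}.$$ Assume that $\nabla g$ is Lipschitz continuous on $\mathcal Y$ with constant $L_g$, i.e. $\|\nabla g(y_1)-\nabla g(y_2)\|\le L_g\|y_1-y_2\|$ for all $y_1,y_2\in\mathcal Y$, and that the step size $\gamma>0$ satisfies $\gamma\le 1/(2\hat L)$, where $$\hat L:=\left(\max\{2L_g^2+\lambda_{\max}(B^\top B),\ 2\lambda_{\max}(B^\top B)\}\right)^{1/2}.$$ Moreover, choose $H:=0$ if $A$ is an identity matrix, and $H:=\tau I-\gamma A^\top A$ with $\tau>\gamma\lambda_{\max}(A^\top A)$ if $A$ is not an identity matrix. Then for any primal-dual optimal solution $(x^*,y^*,\lambda^* )$ of the problem, $$|f(\tilde x^N)+g(\tilde y^N)-f(x^* )-g(y^* )|=O(1/N)\qquad\text{and}\qquad \|A\tilde x^N+B\tilde y^N-b\|=O(1/N),$$ that is, there is a constant $K\ge 0$, independent of $N$, such that both left-hand sides are at most $K/N$ for every integer $N>0$.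
   Context: Setting: $f:\mathbb R^n\to\mathbb R$ and $g:\mathbb R^p\to\mathbb R$ are convex functions, $g$ is differentiable, $A\in\mathbb R^{m\times n}$, $B\in\mathbb R^{m\times p}$, $b\in\mathbb R^m$, and $\mathcal X\subseteq\mathbb R^n$, $\mathcal Y\subseteq\mathbb R^p$ are nonempty closed convex sets. $\|\cdot\|$ is the Euclidean norm, $\lambda_{\max}(\cdot)$ is the largest eigenvalue of a symmetric matrix, $\|x\|_H^2:=x^\top Hx$ for a symmetric positive semidefinite matrix $H$, and $[y]_{\mathcal Y}$ is the Euclidean projection of $y$ onto $\mathcal Y$. A primal-dual optimal solution is a triple $(x^*,y^*,\lambda^* )\in\mathcal X\times\mathcal Y\times\mathbb R^m$ such that $Ax^*+By^*=b$, there is a subgradient $\theta^*\in\partial f(x^* )$ with $\langle x-x^*,\theta^*-A^\top\lambda^*\rangle\ge0$ for all $x\in\mathcal X$, and $\langle y-y^*,\nabla g(y^* )-B^\top\lambda^*\rangle\ge0$ for all $y\in\mathcal Y$. The set of primal-dual optimal solutions is assumed nonempty. The Lagrangian and augmented Lagrangian are $$\mathcal L(x,y;\lambda):=f(x)+g(y)-\langle\lambda,Ax+By-b\rangle,\qquad \mathcal L_\gamma(x,y;\lambda):=\mathcal L(x,y;\lambda)+\tfrac{\gamma}{2}\|Ax+By-b\|^2,$$ so $\nabla_y\mathcal L(x,y;\lambda)=\nabla g(y)-B^\top\lambda$. Algorithm EGADM, with parameter $\gamma>0$ and positive semidefinite $H\in\mathbb R^{n\times n}$: starting from any $x^0\in\mathcal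 X$, $y^0\in\mathcal Y$, $\lambda^0\in\mathbb R^m$, for $k=0,1,2,\dots$ set $$\begin{aligned} x^{k+1}&:=\operatorname{argmin}_{x\in\mathcal X}\ \mathcal L_\gamma(x,y^k;\lambda^k)+\tfrac12\|x-x^k\|_H^2,\\ \bar y^{k+1}&:=[y^k-\gamma\nabla_y\mathcal L(x^{k+1},y^k;\lambda^k)]_{\mathcal Y},\\ \bar\lambda^{k+1}&:=\lambda^k-\gamma(Ax^{k+1}+By^k-b),\\ y^{k+1}&:=[y^k-\gamma\nabla_y\mathcal L(x^{k+1},\bar y^{k+1};\bar\lambda^{k+1})]_{\mathcal Y},\\ \lambda^{k+1}&:=\lambda^k-\gamma(Ax^{k+1}+B\bar y^{k+1}-b). \end{aligned}$$ *)

theory Defs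
  imports "HOL-Analysis.Analysis"
begin

definition gradient :: "('a::real_inner \<Rightarrow> real) \<Rightarrow> 'a \<Rightarrow> 'a" where
  "gradient g y = (THE D. GDERIV g y :> D)"

definition subdifferential :: "('a::real_inner \<Rightarrow> real) \<Rightarrow> 'a \<Rightarrow> 'a set" where
  "subdifferential f x = {\<theta>. \<forall>z. f z \<ge> f x + \<theta> \<bullet> (z - x)}"

text \<open>Only meaningful for symmetric matrices, whose set of real eigenvalues is finite and nonempty.\<close>

definition lambda_max :: "real^'n^'n \<Rightarrow> real" where
  "lambda_max M = Max {\<mu>. \<exists>v. v \<noteq> 0 \<and> M *v v = \<mu> *\<^sub>R v}"

definition sqnorm_wrt :: "real^'n^'n \<Rightarrow> real^'n \<Rightarrow> real" where
  "sqnorm_wrt H x = x \<bullet> (H *v x)"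

text \<open>Rows and columns may be indexed by different types, so \<open>A = mat 1\<close> is not well-typed.
  The linear orders number the rows and the columns; \<open>A\<close> is an identity matrix if it is square and
  its entry is 1 where the row number equals the column number, and 0 elsewhere.\<close>

definition index_pos :: "'a::{finite,linorder} \<Rightarrow> nat" where
  "index_pos i = card {k. k < i}"

definition is_identity_matrix :: "real^'n::{finite,linorder}^'m::{finite,linorder} \<Rightarrow> bool" where
  "is_identity_matrix A \<longleftrightarrow> CARD('m) = CARD('n) \<and>
     (\<forall>i j. A $ i $ j = (if index_pos i = index_pos j then 1 else 0))"

lemma index_pos_eq_iff: "index_pos i = index_pos j \<longleftrightarrow> i = j"
proof -
  have "index_pos i < index_pos j" if "i < j" for i j :: 'a
    unfolding index_pos_def using that by (intro psubset_card_mono) auto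
  then show ?thesis by (metis less_irrefl linorder_less_linear)
qed

lemma is_identity_matrix_square: "is_identity_matrix A \<longleftrightarrow> A = mat 1"
  by (simp add: is_identity_matrix_def index_pos_eq_iff mat_def vec_eq_iff)

definition lagrangian ::
    "(real^'n \<Rightarrow> real) \<Rightarrow> (real^'p \<Rightarrow> real) \<Rightarrow> real^'n^'m \<Rightarrow> real^'p^'m \<Rightarrow> real^'m
     \<Rightarrow> real^'n \<Rightarrow> real^'p \<Rightarrow> real^'m \<Rightarrow> real" where
  "lagrangian f g A B b x y l = f x + g y - l \<bullet> (A *v x + B *v y - b)"

definition augmented_lagrangian ::
    "real \<Rightarrow> (real^'n \<Rightarrow> real) \<Rightarrow> (real^'p \<Rightarrow> real) \<Rightarrow> real^'n^'m \<Rightarrow> real^'p^'m \<Rightarrow> real^'m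
     \<Rightarrow> real^'n \<Rightarrow> real^'p \<Rightarrow> real^'m \<Rightarrow> real" where
  "augmented_lagrangian \<gamma> f g A B b x y l =
     lagrangian f g A B b x y l + \<gamma> / 2 * (norm (A *v x + B *v y - b))\<^sup>2"

definition primal_dual_optimal ::
    "(real^'n \<Rightarrow> real) \<Rightarrow> (real^'p \<Rightarrow> real) \<Rightarrow> real^'n^'m \<Rightarrow> real^'p^'m \<Rightarrow> real^'m
     \<Rightarrow> (real^'n) set \<Rightarrow> (real^'p) set \<Rightarrow> real^'n \<Rightarrow> real^'p \<Rightarrow> real^'m \<Rightarrow> bool" where
  "primal_dual_optimal f g A B b X Y xs ys ls \<longleftrightarrow>
     xs \<in> X \<and> ys \<in> Y \<and> A *v xs + B *v ys = b \<and>
     (\<exists>\<theta>\<in>subdifferential f xs. \<forall>x\<in>X. (x - xs) \<bullet> (\<theta> - transpose A *v ls) \<ge> 0) \<and>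
     (\<forall>y\<in>Y. (y - ys) \<bullet> (gradient g ys - transpose B *v ls) \<ge> 0)"

text \<open>The sequences \<open>yb\<close> and \<open>lb\<close> are the barred iterates; their values at index 0 are not used.\<close>

definition egadm_iterates ::
    "(real^'n \<Rightarrow> real) \<Rightarrow> (real^'p \<Rightarrow> real) \<Rightarrow> real^'n^'m \<Rightarrow> real^'p^'m \<Rightarrow> real^'m
     \<Rightarrow> (real^'n) set \<Rightarrow> (real^'p) set \<Rightarrow> real \<Rightarrow> real^'n^'n
     \<Rightarrow> (nat \<Rightarrow> real^'n) \<Rightarrow> (nat \<Rightarrow> real^'p) \<Rightarrow> (nat \<Rightarrow> real^'p)
     \<Rightarrow> (nat \<Rightarrow> real^'m) \<Rightarrow> (nat \<Rightarrow> real^'m) \<Rightarrow> bool" where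
  "egadm_iterates f g A B b X Y \<gamma> H x y yb l lb \<longleftrightarrow>
     x 0 \<in> X \<and> y 0 \<in> Y \<and>
     (\<forall>k. is_arg_min
            (\<lambda>z. augmented_lagrangian \<gamma> f g A B b z (y k) (l k) + 1 / 2 * sqnorm_wrt H (z - x k))
            (\<lambda>z. z \<in> X) (x (Suc k)) \<and>
          yb (Suc k) = closest_point Y
            (y k - \<gamma> *\<^sub>R gradient (\<lambda>v. lagrangian f g A B b (x (Suc k)) v (l k)) (y k)) \<and>
          lb (Suc k) = l k - \<gamma> *\<^sub>R (A *v x (Suc k) + B *v y k - b) \<and>
          y (Suc k) = closest_point Y
            (y k - \<gamma> *\<^sub>R gradient (\<lambda>v. lagrangian f g A B b (x (Suc k)) v (lb (Suc k)))
                           (yb (Suc k))) \<and>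
          l (Suc k) = l k - \<gamma> *\<^sub>R (A *v x (Suc k) + B *v yb (Suc k) - b))"

definition ergodic_mean :: "(nat \<Rightarrow> 'a::real_vector) \<Rightarrow> nat \<Rightarrow> 'a" where
  "ergodic_mean u N = (1 / real (N + 1)) *\<^sub>R (\<Sum>k=0..N. u (Suc k))"

definition L_hat :: "real \<Rightarrow> real^'p^'m \<Rightarrow> real" where
  "L_hat Lg B = sqrt (max (2 * Lg\<^sup>2 + lambda_max (transpose B ** B))
                          (2 * lambda_max (transpose B ** B)))"

end

theory Submission
  imports Defs
begin

text \<open>Write \<open>r\<close> for the residual of the coupling constraint. For a multiplier \<open>\<nu>\<close>, compare the
  iterates with the point \<open>(xs, ys, \<nu>)\<close>. The proximal subproblem for \<open>x\<close> yields a variational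
  inequality in which the multiplier is exactly the predicted one, \<open>lb\<close>, because the gradient of
  the penalty term shifts \<open>l\<close> to \<open>lb\<close>. The remaining updates of the algorithm are a single
  extragradient step, in the product space, for the monotone operator
  \<open>\<Phi> (y, l) = (\<nabla>g y - B\<^sup>T l, A x + B y - b)\<close> with the new \<open>x\<close> held fixed: the ascent step in \<open>l\<close> is
  the unconstrained component of a projection onto \<open>Y \<times> \<real>\<^sup>m\<close>. This operator has Lipschitz
  constant \<open>L_hat\<close>, and the step size is small enough for the prediction error to be absorbed.
  Adding up, the Lagrangian gap \<open>f + g - f xs - g ys - \<langle>\<nu>, r\<rangle>\<close> of each iteration is
  at most the decrease of a nonnegative quadratic potential
  (\<open>egadm_potential_decrease\<close>). This holds for every \<open>\<nu>\<close> and not only for the optimal multiplier,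
  since every point of \<open>Y \<times> \<real>\<^sup>m\<close> is an admissible comparison point for the extragradient step.

  Telescoping and Jensen's inequality bound the gap at the ergodic means by the initial potential
  divided by \<open>N + 1\<close>. Conversely, optimality of \<open>(xs, ys, ls)\<close> says that the gap is nonnegative for
  \<open>\<nu> = ls\<close>. Choosing instead \<open>\<nu>\<close> at distance one from \<open>ls\<close>, in the direction opposite to \<open>r\<close>,
  isolates \<open>\<parallel>r\<parallel>\<close>, and the bound on the objective follows
  (\<open>bounds_from_shifted_multiplier\<close>).\<close>

section \<open>Gradients and convexity\<close>

lemma gradient_eqI:
  assumes "GDERIV g y :> D"
  shows "gradient g y = D"
proof -
  have "D' = D" if "GDERIV g y :> D'" for D'
  proof -
    have "(\<lambda>h. h \<bullet> D') = (\<lambda>h. h \<bullet> D)"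
      using has_derivative_unique that assms by (metis gderiv_def)
    then show ?thesis
      by (metis inner_commute vector_eq_ldot)
  qed
  then show ?thesis
    unfolding gradient_def using assms by blast
qed

lemma GDERIV_gradient:
  fixes g :: "'a::euclidean_space \<Rightarrow> real"
  assumes "g differentiable (at y)"
  shows "GDERIV g y :> gradient g y"
proof -
  obtain g' where g': "(g has_derivative g') (at y)"
    using assms by (auto simp: differentiable_def)
  then interpret linear g'
    by (rule has_derivative_linear)
  \<comment> \<open>Riesz representation of the derivative.\<close>
  have "g' = (\<lambda>h. h \<bullet> adjoint g' 1)"
    using adjoint_works[OF linear_axioms, of _ 1] by (simp add: fun_eq_iff)
  then have "GDERIV g y :> adjoint g' 1"
    unfolding gderiv_def using g' by metis
  then show ?thesis
    using gradient_eqI by metis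
qed

lemma GDERIV_along_line:
  assumes "GDERIV q u :> D"
  shows "((\<lambda>t. q (u + t *\<^sub>R d)) has_real_derivative d \<bullet> D) (at 0)"
proof -
  have "((\<lambda>t. u + t *\<^sub>R d) has_derivative (\<lambda>t. t *\<^sub>R d)) (at 0)"
    by (auto intro!: derivative_eq_intros)
  moreover have "(q has_derivative (\<lambda>h. h \<bullet> D)) (at (u + 0 *\<^sub>R d))"
    using assms by (simp add: gderiv_def)
  ultimately have "((\<lambda>t. q (u + t *\<^sub>R d)) has_derivative (\<lambda>t. (t *\<^sub>R d) \<bullet> D)) (at 0)"
    by (rule has_derivative_compose)
  then show ?thesis
    by (simp add: has_field_derivative_def mult_commute_abs)
qed

text \<open>Both the tangent inequality of a convex function and the first-order optimality condition
  are obtained by restricting to a segment and applying this one-dimensional fact, so that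
  convexity only has to be used through the chord inequality below.\<close>

lemma deriv_nonneg_at_left_end_minimum:
  fixes \<phi> :: "real \<Rightarrow> real"
  assumes "(\<phi> has_real_derivative s) (at 0)"
    and "\<And>t. 0 < t \<Longrightarrow> t \<le> 1 \<Longrightarrow> \<phi> 0 \<le> \<phi> t"
  shows "0 \<le> s"
proof (rule ccontr)
  assume "\<not> 0 \<le> s"
  then obtain d where d: "d > 0" "\<And>h. 0 < h \<Longrightarrow> h < d \<Longrightarrow> \<phi> h < \<phi> 0"
    using has_real_derivative_neg_dec_right[OF assms(1)] by auto
  define h where "h = min 1 (d / 2)"
  have "0 < h" "h \<le> 1" "h < d"
    using d(1) by (auto simp: h_def)
  then show False
    using assms(2)[of h] d(2)[of h] by linarith
qed

lemma convex_on_line: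
  assumes "convex_on S f" "u \<in> S" "z \<in> S" "0 < t" "t \<le> 1"
  shows "f (u + t *\<^sub>R (z - u)) \<le> f u + t * (f z - f u)"
proof -
  have "u + t *\<^sub>R (z - u) = (1 - t) *\<^sub>R u + t *\<^sub>R z"
    by (simp add: algebra_simps)
  then show ?thesis
    using convex_onD[OF assms(1), of t u z] assms by (simp add: algebra_simps)
qed

lemma convex_on_ge_tangent:
  assumes "convex_on UNIV g" "GDERIV g u :> D"
  shows "g u + (z - u) \<bullet> D \<le> g z"
proof -
  have "((\<lambda>t. t * (g z - g u) - g (u + t *\<^sub>R (z - u))) has_real_derivative
      (g z - g u) - (z - u) \<bullet> D) (at 0)"
    by (auto intro!: derivative_eq_intros GDERIV_along_line[OF assms(2)])
  then have "0 \<le> (g z - g u) - (z - u) \<bullet> D"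
  proof (rule deriv_nonneg_at_left_end_minimum)
    fix t :: real
    assume "0 < t" "t \<le> 1"
    then show "0 * (g z - g u) - g (u + 0 *\<^sub>R (z - u))
        \<le> t * (g z - g u) - g (u + t *\<^sub>R (z - u))"
      using convex_on_line[OF assms(1), of u z t] by simp
  qed
  then show ?thesis by simp
qed

text \<open>The optimality condition for a composite objective: only the smooth part \<open>q\<close> is linearized,
  so that no subgradient of \<open>f\<close> at the minimizer has to be produced.\<close>

lemma composite_minimizer_variational_inequality:
  assumes f: "convex_on UNIV f" and q: "GDERIV q u :> D"
    and X: "convex X" "u \<in> X" "z \<in> X"
    and min: "\<And>w. w \<in> X \<Longrightarrow> f u + q u \<le> f w + q w"
  shows "0 \<le> f z - f u + (z - u) \<bullet> D"
proof -
  let ?w = "\<lambda>t. u + t *\<^sub>R (z - u)"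
  have w: "?w t \<in> X" if "0 < t" "t \<le> 1" for t
    using convexD_alt[OF X(1,2,3), of t] that by (simp add: algebra_simps)
  have "((\<lambda>t. t * (f z - f u) + q (?w t)) has_real_derivative
      (f z - f u) + (z - u) \<bullet> D) (at 0)"
    by (auto intro!: derivative_eq_intros GDERIV_along_line[OF q])
  then show ?thesis
  proof (rule deriv_nonneg_at_left_end_minimum)
    fix t :: real
    assume t: "0 < t" "t \<le> 1"
    have "f (?w t) \<le> f u + t * (f z - f u)"
      using convex_on_line[OF f, of u z t] t by simp
    moreover have "f u + q u \<le> f (?w t) + q (?w t)"
      by (rule min[OF w[OF t]])
    ultimately show "0 * (f z - f u) + q (?w 0) \<le> t * (f z - f u) + q (?w t)"
      by simp
  qed
qed

section \<open>The largest eigenvalue of a symmetric matrix\<close>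

lemma inner_transpose_mult:
  fixes A :: "real^'n^'m"
  shows "(transpose A *v v) \<bullet> w = v \<bullet> (A *v w)"
  by (simp add: dot_lmul_matrix)

lemma symmetric_gram: "transpose (transpose A ** A) = transpose A ** (A :: real^'n^'m)"
  by (simp add: matrix_transpose_mul)

lemma quadratic_form_gram:
  fixes A :: "real^'n^'m"
  shows "v \<bullet> ((transpose A ** A) *v v) = (norm (A *v v))\<^sup>2"
  by (metis inner_commute inner_transpose_mult matrix_vector_mul_assoc power2_norm_eq_inner)

lemma symmetric_inner:
  fixes M :: "real^'n^'n"
  assumes "transpose M = M"
  shows "v \<bullet> (M *v w) = (M *v v) \<bullet> w"
  using inner_transpose_mult[of M v w] assms by simp

text \<open>Eigenvectors for distinct eigenvalues are orthogonal, hence linearly independent.\<close>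

lemma finite_symmetric_eigenvalues:
  fixes M :: "real^'n^'n"
  assumes M: "transpose M = M"
  shows "finite {\<mu>. \<exists>v. v \<noteq> 0 \<and> M *v v = \<mu> *\<^sub>R v}" (is "finite ?E")
proof -
  have "\<forall>\<mu>\<in>?E. \<exists>v. v \<noteq> 0 \<and> M *v v = \<mu> *\<^sub>R v"
    by blast
  from bchoice[OF this] obtain e
    where e: "\<And>\<mu>. \<mu> \<in> ?E \<Longrightarrow> e \<mu> \<noteq> 0" "\<And>\<mu>. \<mu> \<in> ?E \<Longrightarrow> M *v e \<mu> = \<mu> *\<^sub>R e \<mu>"
    by blast
  have orth: "e \<mu> \<bullet> e \<nu> = 0" if "\<mu> \<in> ?E" "\<nu> \<in> ?E" "\<mu> \<noteq> \<nu>" for \<mu> \<nu>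
  proof -
    have "\<nu> * (e \<mu> \<bullet> e \<nu>) = \<mu> * (e \<mu> \<bullet> e \<nu>)"
      using symmetric_inner[OF M, of "e \<mu>" "e \<nu>"] e(2)[OF that(1)] e(2)[OF that(2)] by simp
    with that(3) show ?thesis by simp
  qed
  have "inj_on e ?E"
  proof (rule inj_onI, rule ccontr)
    fix \<mu> \<nu>
    assume *: "\<mu> \<in> ?E" "\<nu> \<in> ?E" "e \<mu> = e \<nu>" "\<mu> \<noteq> \<nu>"
    then have "e \<mu> \<bullet> e \<mu> = 0"
      using orth[OF *(1,2,4)] by simp
    with e(1)[OF *(1)] show False
      by simp
  qed
  moreover have "independent (e ` ?E)"
  proof (rule pairwise_orthogonal_independent)
    show "pairwise orthogonal (e ` ?E)"
      unfolding pairwise_def orthogonal_def using orth by blast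
    show "0 \<notin> e ` ?E"
      using e(1) by force
  qed
  ultimately show ?thesis
    using finite_imageD independent_imp_finite by blast
qed

text \<open>A maximizer \<open>e\<close> of the quadratic form on the unit sphere minimizes
  \<open>\<mu> \<parallel>w\<parallel>\<^sup>2 - \<langle>w, M w\<rangle>\<close> over the whole space, where \<open>\<mu>\<close> is the maximum; the gradient of
  that function vanishes at \<open>e\<close>, which says that \<open>\<mu>\<close> is an eigenvalue.\<close>

lemma quadratic_form_le_lambda_max:
  fixes M :: "real^'n^'n"
  assumes M: "transpose M = M"
  shows "v \<bullet> (M *v v) \<le> lambda_max M * (norm v)\<^sup>2"
proof -
  have "continuous_on (sphere 0 1) (\<lambda>w::real^'n. w \<bullet> (M *v w))"
    by (intro continuous_intros linear_continuous_on) simp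
  moreover have "sphere (0::real^'n) 1 \<noteq> {}"
    by simp
  ultimately obtain e where e: "norm e = 1"
    and max: "\<And>w. norm w = 1 \<Longrightarrow> w \<bullet> (M *v w) \<le> e \<bullet> (M *v e)"
    using continuous_attains_sup[of "sphere 0 1" "\<lambda>w::real^'n. w \<bullet> (M *v w)"] by auto
  define \<mu> where "\<mu> = e \<bullet> (M *v e)"
  define q where "q w = \<mu> * (w \<bullet> w) - w \<bullet> (M *v w)" for w
  have q_nonneg: "0 \<le> q w" for w
  proof (cases "w = 0")
    case False
    let ?u = "(1 / norm w) *\<^sub>R w"
    have "?u \<bullet> (M *v ?u) \<le> \<mu>"
      unfolding \<mu>_def using False by (intro max) simp
    then have "(w \<bullet> (M *v w)) / (norm w * norm w) \<le> \<mu>"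
      by (simp add: matrix_vector_mult_scaleR)
    then have "w \<bullet> (M *v w) \<le> \<mu> * (norm w * norm w)"
      using False by (simp add: pos_divide_le_eq)
    then show ?thesis
      by (simp add: q_def flip: power2_norm_eq_inner power2_eq_square)
  qed (simp add: q_def)
  have "q e = 0"
    using e by (simp add: q_def \<mu>_def norm_eq_1)
  have "((\<lambda>w. M *v w) has_derivative (\<lambda>h. M *v h)) (at e)"
    by (simp add: bounded_linear_imp_has_derivative)
  then have "(q has_derivative
      (\<lambda>h. \<mu> * (e \<bullet> h + h \<bullet> e) - (e \<bullet> (M *v h) + h \<bullet> (M *v e)))) (at e)"
    unfolding q_def
    by (intro has_derivative_diff has_derivative_mult_right has_derivative_inner
        has_derivative_ident)
  also have "(\<lambda>h. \<mu> * (e \<bullet> h + h \<bullet> e) - (e \<bullet> (M *v h) + h \<bullet> (M *v e)))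
      = (\<lambda>h. h \<bullet> (2 *\<^sub>R (\<mu> *\<^sub>R e - M *v e)))"
    using symmetric_inner[OF M, of e]
    by (simp add: fun_eq_iff inner_diff_right inner_commute[of _ e] inner_commute[of _ "M *v e"])
  finally have "GDERIV q e :> 2 *\<^sub>R (\<mu> *\<^sub>R e - M *v e)"
    by (simp only: gderiv_def)
  then have "0 \<le> (\<lambda>_. 0) z - (\<lambda>_. 0) e + (z - e) \<bullet> (2 *\<^sub>R (\<mu> *\<^sub>R e - M *v e))" for z
    by (intro composite_minimizer_variational_inequality[where X=UNIV and q=q])
      (auto simp: \<open>q e = 0\<close> q_nonneg convex_on_def)
  from this[of "e - (\<mu> *\<^sub>R e - M *v e)"]
  have "0 \<le> (- (\<mu> *\<^sub>R e - M *v e)) \<bullet> (2 *\<^sub>R (\<mu> *\<^sub>R e - M *v e))"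
    by simp
  then have "(norm (\<mu> *\<^sub>R e - M *v e))\<^sup>2 \<le> 0"
    unfolding power2_norm_eq_inner inner_minus_left inner_scaleR_right by linarith
  then have "M *v e = \<mu> *\<^sub>R e"
    by simp
  moreover have "e \<noteq> 0"
    using e by auto
  ultimately have "\<mu> \<le> lambda_max M"
    unfolding lambda_max_def
    by (intro Max_ge finite_symmetric_eigenvalues[OF M]) blast
  moreover have "v \<bullet> (M *v v) \<le> \<mu> * (norm v)\<^sup>2"
    using q_nonneg[of v] by (simp add: q_def power2_norm_eq_inner)
  ultimately show ?thesis
    by (meson mult_right_mono order_trans zero_le_power2)
qed

lemma norm_mult_le_lambda_max:
  fixes B :: "real^'p^'m"
  shows "(norm (B *v v))\<^sup>2 \<le> lambda_max (transpose B ** B) * (norm v)\<^sup>2"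
  using quadratic_form_le_lambda_max[OF symmetric_gram, of v B]
  by (simp only: quadratic_form_gram)

lemma lambda_max_gram_nonneg:
  fixes B :: "real^'p^'m"
  shows "0 \<le> lambda_max (transpose B ** B)"
proof -
  have "0 \<le> lambda_max (transpose B ** B) * (norm (axis undefined 1 :: real^'p))\<^sup>2"
    using norm_mult_le_lambda_max[of B "axis undefined 1"] zero_le_power2 order_trans by blast
  then show ?thesis
    by simp
qed

text \<open>A matrix and its transpose have the same operator norm: by Cauchy-Schwarz,
  \<open>\<parallel>B\<^sup>T v\<parallel>\<^sup>2 = \<langle>v, B B\<^sup>T v\<rangle> \<le> \<parallel>v\<parallel> \<parallel>B (B\<^sup>T v)\<parallel>\<close>, and one factor \<open>\<parallel>B\<^sup>T v\<parallel>\<close> cancels.\<close>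

lemma norm_transpose_mult_le_lambda_max:
  fixes B :: "real^'p^'m"
  shows "(norm (transpose B *v v))\<^sup>2 \<le> lambda_max (transpose B ** B) * (norm v)\<^sup>2"
proof (cases "transpose B *v v = 0")
  case False
  let ?w = "transpose B *v v"
  have "(norm ?w)\<^sup>2 = v \<bullet> (B *v ?w)"
    by (simp only: power2_norm_eq_inner inner_transpose_mult)
  also have "\<dots> \<le> norm v * norm (B *v ?w)"
    by (rule norm_cauchy_schwarz)
  finally have "((norm ?w)\<^sup>2)\<^sup>2 \<le> (norm v * norm (B *v ?w))\<^sup>2"
    by (rule power_mono) simp
  also have "\<dots> \<le> (norm v)\<^sup>2 * (lambda_max (transpose B ** B) * (norm ?w)\<^sup>2)"
    using norm_mult_le_lambda_max[of B ?w] by (simp add: power_mult_distrib mult_left_mono)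
  finally have "(norm ?w)\<^sup>2 * (norm ?w)\<^sup>2
      \<le> (lambda_max (transpose B ** B) * (norm v)\<^sup>2) * (norm ?w)\<^sup>2"
    by (simp add: power2_eq_square mult_ac)
  then show ?thesis
    using False by (simp only: mult_le_cancel_right) simp
qed (simp add: lambda_max_gram_nonneg)

section \<open>One iteration of the algorithm\<close>

text \<open>The source of the constant \<open>L_hat\<close>. The vector \<open>d\<close> is a difference of gradients of \<open>g\<close>, and the
  pair on the left is the corresponding difference of values of the saddle-point operator. The
  cross term of the first component is removed by \<open>\<parallel>d - w\<parallel>\<^sup>2 \<le> 2 \<parallel>d\<parallel>\<^sup>2 + 2 \<parallel>w\<parallel>\<^sup>2\<close>; the two
  arguments of the maximum are the resulting coefficients of \<open>\<parallel>dy\<parallel>\<^sup>2\<close> and \<open>\<parallel>dl\<parallel>\<^sup>2\<close>.\<close>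

lemma saddle_operator_lipschitz:
  fixes B :: "real^'p^'m"
  assumes d: "norm d \<le> Lg * norm dy"
  shows "norm (d - transpose B *v dl, B *v dy) \<le> L_hat Lg B * norm (dy, dl)"
proof -
  define \<Lambda> where "\<Lambda> = lambda_max (transpose B ** B)"
  define M where "M = max (2 * Lg\<^sup>2 + \<Lambda>) (2 * \<Lambda>)"
  let ?w = "transpose B *v dl"
  have "(norm (d - ?w))\<^sup>2 + (norm (d + ?w))\<^sup>2 = 2 * (norm d)\<^sup>2 + 2 * (norm ?w)\<^sup>2"
    by (simp add: power2_norm_eq_inner inner_diff_left inner_diff_right inner_add_left
        inner_add_right)
  then have "(norm (d - ?w))\<^sup>2 \<le> 2 * (norm d)\<^sup>2 + 2 * (norm ?w)\<^sup>2"
    using zero_le_power2[of "norm (d + ?w)"] by linarith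
  moreover have "(norm d)\<^sup>2 \<le> Lg\<^sup>2 * (norm dy)\<^sup>2"
    using power_mono[OF d, of 2] by (simp add: power_mult_distrib)
  moreover have "(norm ?w)\<^sup>2 \<le> \<Lambda> * (norm dl)\<^sup>2"
    unfolding \<Lambda>_def by (rule norm_transpose_mult_le_lambda_max)
  moreover have "(norm (B *v dy))\<^sup>2 \<le> \<Lambda> * (norm dy)\<^sup>2"
    unfolding \<Lambda>_def by (rule norm_mult_le_lambda_max)
  ultimately have "(norm (d - ?w))\<^sup>2 + (norm (B *v dy))\<^sup>2
      \<le> (2 * Lg\<^sup>2 + \<Lambda>) * (norm dy)\<^sup>2 + (2 * \<Lambda>) * (norm dl)\<^sup>2"
    by (simp only: distrib_right)
  also have "\<dots> \<le> M * (norm dy)\<^sup>2 + M * (norm dl)\<^sup>2"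
    unfolding M_def by (intro add_mono mult_right_mono) auto
  finally have "(norm (d - ?w))\<^sup>2 + (norm (B *v dy))\<^sup>2 \<le> M * ((norm dy)\<^sup>2 + (norm dl)\<^sup>2)"
    by (simp only: distrib_left)
  then show ?thesis
    unfolding norm_Pair L_hat_def M_def \<Lambda>_def real_sqrt_mult[symmetric]
    by (rule real_sqrt_le_mono)
qed

lemma L_hat_nonneg: "0 \<le> L_hat Lg B"
  using lambda_max_gram_nonneg[of B] by (simp add: L_hat_def le_max_iff_disj)

text \<open>Here \<open>\<Phi>\<close> and \<open>\<Phi>b\<close> are the values of the operator at \<open>u\<close> and at the predictor \<open>ub\<close>. The
  projections enter only through their obtuse-angle property: the predictor is tested against the
  corrected point \<open>u1\<close>, and \<open>u1\<close> against the comparison point \<open>z\<close>. By the three-point identity the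
  two inequalities leave the negative terms \<open>- \<parallel>u - ub\<parallel>\<^sup>2 - \<parallel>ub - u1\<parallel>\<^sup>2\<close>, which pay for the error
  of having used \<open>\<Phi>\<close> instead of \<open>\<Phi>b\<close> in the prediction.\<close>

lemma extragradient_step:
  fixes u ub u1 z \<Phi> \<Phi>b :: "'a::real_inner"
  assumes predict: "(u - \<gamma> *\<^sub>R \<Phi> - ub) \<bullet> (u1 - ub) \<le> 0"
    and correct: "(u - \<gamma> *\<^sub>R \<Phi>b - u1) \<bullet> (z - u1) \<le> 0"
    and step: "norm (\<gamma> *\<^sub>R (\<Phi>b - \<Phi>)) \<le> norm (ub - u)"
  shows "2 * \<gamma> * (\<Phi>b \<bullet> (ub - z)) \<le> (norm (u - z))\<^sup>2 - (norm (u1 - z))\<^sup>2"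
proof -
  have "(\<gamma> *\<^sub>R (\<Phi>b - \<Phi>)) \<bullet> (ub - u1) \<le> norm (\<gamma> *\<^sub>R (\<Phi>b - \<Phi>)) * norm (ub - u1)"
    by (rule norm_cauchy_schwarz)
  also have "\<dots> \<le> norm (ub - u) * norm (ub - u1)"
    using step by (rule mult_right_mono) simp
  finally have "2 * ((\<gamma> *\<^sub>R (\<Phi>b - \<Phi>)) \<bullet> (ub - u1)) \<le> (norm (ub - u))\<^sup>2 + (norm (ub - u1))\<^sup>2"
    using sum_squares_bound[of "norm (ub - u)" "norm (ub - u1)"] by linarith
  with predict correct show ?thesis
    unfolding power2_norm_eq_inner
    by (simp add: inner_commute algebra_simps)
qed

lemma gradient_lagrangian:
  fixes g :: "real^'p \<Rightarrow> real" and B :: "real^'p^'m"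
  assumes "g differentiable (at v)"
  shows "gradient (\<lambda>v. lagrangian f g A B b x v l) v = gradient g v - transpose B *v l"
proof (rule gradient_eqI)
  have "(g has_derivative (\<lambda>h. h \<bullet> gradient g v)) (at v)"
    using GDERIV_gradient[OF assms] by (simp add: gderiv_def)
  moreover have "((\<lambda>v. B *v v) has_derivative (\<lambda>h. B *v h)) (at v)"
    by (simp add: bounded_linear_imp_has_derivative)
  ultimately have "((\<lambda>v. f x + g v - l \<bullet> (A *v x + B *v v - b)) has_derivative
      (\<lambda>h. h \<bullet> gradient g v - l \<bullet> (B *v h))) (at v)"
    by (auto intro!: derivative_eq_intros)
  then show "GDERIV (\<lambda>v. lagrangian f g A B b x v l) v :> gradient g v - transpose B *v l"
    by (simp add: lagrangian_def gderiv_def inner_diff_right inner_commute[of _ "l v* B"]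
        dot_lmul_matrix)
qed

text \<open>The gradients of the multiplier term and of the penalty combine to
  \<open>- A\<^sup>T (l - \<gamma> (A u + B v - b))\<close>, so the multiplier that appears is the predicted one of the
  algorithm.\<close>

lemma proximal_step_variational_inequality:
  fixes A :: "real^'n^'m" and B :: "real^'p^'m" and H :: "real^'n^'n"
  assumes f: "convex_on UNIV f" and X: "convex X" "z \<in> X" and H: "transpose H = H"
    and min: "is_arg_min
      (\<lambda>w. augmented_lagrangian \<gamma> f g A B b w v l + 1 / 2 * sqnorm_wrt H (w - x)) (\<lambda>w. w \<in> X) u"
  shows "0 \<le> f z - f u - (l - \<gamma> *\<^sub>R (A *v u + B *v v - b)) \<bullet> (A *v (z - u))
    + (z - u) \<bullet> (H *v (u - x))"
proof -
  define r where "r w = A *v w + B *v v - b" for w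
  define q where "q w = g v - l \<bullet> r w + \<gamma> / 2 * (r w \<bullet> r w) + 1 / 2 * ((w - x) \<bullet> (H *v (w - x)))"
    for w
  have u: "u \<in> X" "\<And>w. w \<in> X \<Longrightarrow> f u + q u \<le> f w + q w"
    using min unfolding is_arg_min_def q_def r_def augmented_lagrangian_def lagrangian_def
      sqnorm_wrt_def power2_norm_eq_inner by (auto simp: not_less algebra_simps)
  have r': "(r has_derivative (\<lambda>h. A *v h)) (at u)"
  proof -
    have "((\<lambda>w. A *v w) has_derivative (\<lambda>h. A *v h)) (at u)"
      by (simp add: bounded_linear_imp_has_derivative)
    then show ?thesis
      unfolding r_def by (auto intro!: derivative_eq_intros)
  qed
  have shift': "((\<lambda>w. w - x) has_derivative (\<lambda>h. h)) (at u)"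
    by (auto intro!: derivative_eq_intros)
  have H': "((\<lambda>w. H *v (w - x)) has_derivative (\<lambda>h. H *v h)) (at u)"
  proof -
    have "((\<lambda>w. H *v w) has_derivative (\<lambda>h. H *v h)) (at (u - x))"
      by (simp add: bounded_linear_imp_has_derivative)
    with shift' show ?thesis
      by (rule has_derivative_compose)
  qed
  have "(q has_derivative (\<lambda>h. 0 - l \<bullet> (A *v h) + \<gamma> / 2 * (r u \<bullet> (A *v h) + (A *v h) \<bullet> r u)
      + 1 / 2 * ((u - x) \<bullet> (H *v h) + h \<bullet> (H *v (u - x))))) (at u)"
    unfolding q_def
    by (intro r' H' shift' has_derivative_add has_derivative_diff has_derivative_const
        has_derivative_mult_right has_derivative_inner_right has_derivative_inner)
  also have "(\<lambda>h. 0 - l \<bullet> (A *v h) + \<gamma> / 2 * (r u \<bullet> (A *v h) + (A *v h) \<bullet> r u)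
      + 1 / 2 * ((u - x) \<bullet> (H *v h) + h \<bullet> (H *v (u - x))))
    = (\<lambda>h. h \<bullet> (H *v (u - x) - transpose A *v (l - \<gamma> *\<^sub>R r u)))"
  proof
    fix h
    have "h \<bullet> (transpose A *v (l - \<gamma> *\<^sub>R r u)) = l \<bullet> (A *v h) - \<gamma> * (r u \<bullet> (A *v h))"
      unfolding inner_commute[of h] inner_transpose_mult by (simp add: inner_diff_left)
    moreover have "(u - x) \<bullet> (H *v h) = h \<bullet> (H *v (u - x))"
      by (simp only: symmetric_inner[OF H] inner_commute)
    ultimately show "0 - l \<bullet> (A *v h) + \<gamma> / 2 * (r u \<bullet> (A *v h) + (A *v h) \<bullet> r u)
        + 1 / 2 * ((u - x) \<bullet> (H *v h) + h \<bullet> (H *v (u - x)))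
      = h \<bullet> (H *v (u - x) - transpose A *v (l - \<gamma> *\<^sub>R r u))"
      unfolding inner_commute[of "A *v h" "r u"] inner_diff_right[of h] by simp
  qed
  finally have "GDERIV q u :> H *v (u - x) - transpose A *v (l - \<gamma> *\<^sub>R r u)"
    by (simp only: gderiv_def)
  from composite_minimizer_variational_inequality[OF f this X(1) u(1) X(2) u(2)]
  have "0 \<le> f z - f u + (z - u) \<bullet> (H *v (u - x) - transpose A *v (l - \<gamma> *\<^sub>R r u))" .
  also have "(z - u) \<bullet> (H *v (u - x) - transpose A *v (l - \<gamma> *\<^sub>R r u))
      = (z - u) \<bullet> (H *v (u - x)) - (l - \<gamma> *\<^sub>R r u) \<bullet> (A *v (z - u))"
    unfolding inner_diff_right[of "z - u" "H *v (u - x)"]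
      inner_commute[of "z - u" "transpose A *v (l - \<gamma> *\<^sub>R r u)"] inner_transpose_mult ..
  finally show ?thesis
    unfolding r_def by linarith
qed

text \<open>The identity \<open>2 \<langle>z - u, H (u - x)\<rangle> = \<parallel>x - z\<parallel>\<^sub>H\<^sup>2 - \<parallel>u - z\<parallel>\<^sub>H\<^sup>2 - \<parallel>u - x\<parallel>\<^sub>H\<^sup>2\<close> with its last term
  dropped.\<close>

lemma sqnorm_wrt_three_points:
  fixes H :: "real^'n^'n"
  assumes H: "transpose H = H" and psd: "\<And>v. 0 \<le> sqnorm_wrt H v"
  shows "(z - u) \<bullet> (H *v (u - x)) \<le> 1 / 2 * sqnorm_wrt H (x - z) - 1 / 2 * sqnorm_wrt H (u - z)"
proof -
  define p d where "p = u - x" and "d = x - z"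
  have eqs: "z - u = - (d + p)" "u - x = p" "x - z = d" "u - z = d + p"
    by (simp_all add: p_def d_def)
  have "p \<bullet> (H *v d) = d \<bullet> (H *v p)"
    using symmetric_inner[OF H, of p d] by (simp add: inner_commute)
  then show ?thesis
    unfolding eqs using psd[of p]
    by (simp add: sqnorm_wrt_def inner_add_left inner_add_right inner_diff_left
        matrix_vector_right_distrib field_simps)
qed

definition egadm_potential ::
    "real \<Rightarrow> real^'n^'n \<Rightarrow> real^'n \<Rightarrow> real^'p \<Rightarrow> real^'m \<Rightarrow> real^'n \<Rightarrow> real^'p \<Rightarrow> real^'m \<Rightarrow> real" where
  "egadm_potential \<gamma> H xs ys \<nu> x y l =
     1 / 2 * sqnorm_wrt H (x - xs) + ((norm (y - ys))\<^sup>2 + (norm (l - \<nu>))\<^sup>2) / (2 * \<gamma>)"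

lemma egadm_iterates_in:
  assumes "egadm_iterates f g A B b X Y \<gamma> H x y yb l lb" "closed Y"
  shows "x k \<in> X" "y k \<in> Y" "yb (Suc k) \<in> Y"
proof -
  have it: "x 0 \<in> X" "y 0 \<in> Y" "\<And>j. x (Suc j) \<in> X"
    "\<And>j. \<exists>w. y (Suc j) = closest_point Y w" "\<And>j. \<exists>w. yb (Suc j) = closest_point Y w"
    using assms(1) by (auto simp: egadm_iterates_def is_arg_min_def)
  have "Y \<noteq> {}"
    using it(2) by blast
  then have P: "closest_point Y w \<in> Y" for w
    using assms(2) closest_point_in_set by blast
  show "x k \<in> X"
    using it(1,3) by (cases k) auto
  show "y k \<in> Y"
    using it(2,4) P by (cases k) (simp, metis)
  show "yb (Suc k) \<in> Y"
    using it(5) P by metis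
qed

text \<open>The two variational inequalities share the multiplier \<open>lb (Suc k)\<close>. By the feasibility of
  \<open>(xs, ys)\<close>, their bilinear terms add up to the pairing of this multiplier with the residual, and
  the second component of the extragradient inequality replaces it by \<open>\<nu>\<close>.\<close>

lemma egadm_potential_decrease:
  fixes A :: "real^'n^'m" and B :: "real^'p^'m" and H :: "real^'n^'n" and \<gamma> :: real
  assumes f: "convex_on UNIV f" and g: "convex_on UNIV g" "\<And>v. g differentiable (at v)"
    and X: "convex X" "xs \<in> X" and Y: "closed Y" "convex Y" "ys \<in> Y"
    and feasible: "A *v xs + B *v ys = b"
    and lip: "Lg-lipschitz_on Y (gradient g)"
    and \<gamma>: "0 < \<gamma>" "\<gamma> * L_hat Lg B \<le> 1"
    and H: "transpose H = H" "\<And>v. 0 \<le> sqnorm_wrt H v"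
    and it: "egadm_iterates f g A B b X Y \<gamma> H x y yb l lb"
  shows "f (x (Suc k)) + g (yb (Suc k)) - f xs - g ys
      - \<nu> \<bullet> (A *v x (Suc k) + B *v yb (Suc k) - b)
    \<le> egadm_potential \<gamma> H xs ys \<nu> (x k) (y k) (l k)
      - egadm_potential \<gamma> H xs ys \<nu> (x (Suc k)) (y (Suc k)) (l (Suc k))"
proof -
  define x1 y1 yb1 l1 lb1 where defs: "x1 = x (Suc k)" "y1 = y (Suc k)" "yb1 = yb (Suc k)"
    "l1 = l (Suc k)" "lb1 = lb (Suc k)"
  define \<Phi> where "\<Phi> v w = (gradient g v - transpose B *v w, A *v x1 + B *v v - b)" for v w
  have in_Y: "y k \<in> Y" "yb1 \<in> Y" "y1 \<in> Y"
    unfolding defs by (rule egadm_iterates_in[OF it Y(1)])+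
  have upd: "is_arg_min (\<lambda>z. augmented_lagrangian \<gamma> f g A B b z (y k) (l k)
        + 1 / 2 * sqnorm_wrt H (z - x k)) (\<lambda>z. z \<in> X) x1"
    "yb1 = closest_point Y (y k - \<gamma> *\<^sub>R (gradient g (y k) - transpose B *v l k))"
    "lb1 = l k - \<gamma> *\<^sub>R (A *v x1 + B *v y k - b)"
    "y1 = closest_point Y (y k - \<gamma> *\<^sub>R (gradient g yb1 - transpose B *v lb1))"
    "l1 = l k - \<gamma> *\<^sub>R (A *v x1 + B *v yb1 - b)"
    using it unfolding egadm_iterates_def gradient_lagrangian[OF g(2)] defs by blast+

  have x_step: "0 \<le> f xs - f x1 - lb1 \<bullet> (A *v (xs - x1)) + (xs - x1) \<bullet> (H *v (x1 - x k))"
    using proximal_step_variational_inequality[OF f X H(1) upd(1)] by (simp only: upd(3))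

  have saddle_step: "2 * \<gamma> * (\<Phi> yb1 lb1 \<bullet> ((yb1, lb1) - (ys, \<nu>)))
      \<le> (norm ((y k, l k) - (ys, \<nu>)))\<^sup>2 - (norm ((y1, l1) - (ys, \<nu>)))\<^sup>2"
  proof (rule extragradient_step)
    show "((y k, l k) - \<gamma> *\<^sub>R \<Phi> (y k) (l k) - (yb1, lb1)) \<bullet> ((y1, l1) - (yb1, lb1)) \<le> 0"
      using closest_point_dot[OF Y(2,1) in_Y(3),
          of "y k - \<gamma> *\<^sub>R (gradient g (y k) - transpose B *v l k)", folded upd(2)]
      by (simp add: \<Phi>_def upd(3))
    show "((y k, l k) - \<gamma> *\<^sub>R \<Phi> yb1 lb1 - (y1, l1)) \<bullet> ((ys, \<nu>) - (y1, l1)) \<le> 0"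
      using closest_point_dot[OF Y(2,1,3),
          of "y k - \<gamma> *\<^sub>R (gradient g yb1 - transpose B *v lb1)", folded upd(4)]
      by (simp add: \<Phi>_def upd(5))
    have "norm (gradient g yb1 - gradient g (y k)) \<le> Lg * norm (yb1 - y k)"
      using lipschitz_onD[OF lip in_Y(2,1)] by (simp add: dist_norm)
    \<comment> \<open>The matrix \<open>A\<close> cancels because both values of \<open>\<Phi>\<close> are taken at the new \<open>x\<close>.\<close>
    moreover have "\<Phi> yb1 lb1 - \<Phi> (y k) (l k) =
        (gradient g yb1 - gradient g (y k) - transpose B *v (lb1 - l k), B *v (yb1 - y k))"
      unfolding \<Phi>_def diff_Pair matrix_vector_mult_diff_distrib by simp
    ultimately have "norm (\<Phi> yb1 lb1 - \<Phi> (y k) (l k))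
        \<le> L_hat Lg B * norm ((yb1, lb1) - (y k, l k))"
      by (simp only: saddle_operator_lipschitz diff_Pair)
    then have "\<gamma> * norm (\<Phi> yb1 lb1 - \<Phi> (y k) (l k))
        \<le> (\<gamma> * L_hat Lg B) * norm ((yb1, lb1) - (y k, l k))"
      using \<gamma>(1) by simp
    also have "\<dots> \<le> 1 * norm ((yb1, lb1) - (y k, l k))"
      using \<gamma>(2) by (rule mult_right_mono) simp
    finally show "norm (\<gamma> *\<^sub>R (\<Phi> yb1 lb1 - \<Phi> (y k) (l k))) \<le> norm ((yb1, lb1) - (y k, l k))"
      using \<gamma>(1) by simp
  qed
  have saddle: "\<Phi> yb1 lb1 \<bullet> ((yb1, lb1) - (ys, \<nu>))
      \<le> ((norm (y k - ys))\<^sup>2 + (norm (l k - \<nu>))\<^sup>2) / (2 * \<gamma>)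
        - ((norm (y1 - ys))\<^sup>2 + (norm (l1 - \<nu>))\<^sup>2) / (2 * \<gamma>)"
    unfolding diff_divide_distrib[symmetric] using saddle_step \<gamma>(1)
    by (simp add: norm_Pair pos_le_divide_eq mult_ac)

  have "g yb1 + (ys - yb1) \<bullet> gradient g yb1 \<le> g ys"
    by (intro convex_on_ge_tangent g(1) GDERIV_gradient g(2))
  moreover have "\<Phi> yb1 lb1 \<bullet> ((yb1, lb1) - (ys, \<nu>))
      = - ((ys - yb1) \<bullet> gradient g yb1) - lb1 \<bullet> (B *v (yb1 - ys))
        + lb1 \<bullet> (A *v x1 + B *v yb1 - b) - \<nu> \<bullet> (A *v x1 + B *v yb1 - b)"
    unfolding \<Phi>_def diff_Pair inner_Pair inner_diff_left[of "gradient g yb1"] inner_transpose_mult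
    by (simp add: inner_diff_left inner_diff_right inner_commute)
  moreover have "lb1 \<bullet> (A *v x1 + B *v yb1 - b) = lb1 \<bullet> (B *v (yb1 - ys)) - lb1 \<bullet> (A *v (xs - x1))"
    unfolding feasible[symmetric] by (simp add: inner_diff_right inner_add_right
        matrix_vector_mult_diff_distrib)
  ultimately have "f x1 + g yb1 - f xs - g ys - \<nu> \<bullet> (A *v x1 + B *v yb1 - b)
      \<le> (xs - x1) \<bullet> (H *v (x1 - x k)) + \<Phi> yb1 lb1 \<bullet> ((yb1, lb1) - (ys, \<nu>))"
    using x_step by linarith
  also have "\<dots> \<le> egadm_potential \<gamma> H xs ys \<nu> (x k) (y k) (l k)
      - egadm_potential \<gamma> H xs ys \<nu> x1 y1 l1"
    using saddle sqnorm_wrt_three_points[OF H, of xs x1 "x k"]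
    unfolding egadm_potential_def by linarith
  finally show ?thesis
    unfolding defs .
qed

section \<open>Ergodic means and the rate\<close>

lemma ergodic_mean_in_convex:
  assumes "convex S" "\<And>k. u (Suc k) \<in> S"
  shows "ergodic_mean u N \<in> S"
proof -
  have "(\<Sum>k=0..N. (1 / real (N + 1)) *\<^sub>R u (Suc k)) \<in> S"
    using assms by (intro convex_sum) auto
  then show ?thesis
    by (simp add: ergodic_mean_def scaleR_sum_right)
qed

lemma convex_on_ergodic_mean:
  fixes u :: "nat \<Rightarrow> 'a::real_vector"
  assumes "convex_on UNIV f"
  shows "f (ergodic_mean u N) \<le> ergodic_mean (\<lambda>k. f (u k)) N"
proof -
  have "f (\<Sum>k=0..N. (1 / real (N + 1)) *\<^sub>R u (Suc k)) \<le> (\<Sum>k=0..N. 1 / real (N + 1) * f (u (Suc k)))"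
    using assms by (intro convex_on_sum) auto
  then show ?thesis
    by (simp add: ergodic_mean_def scaleR_sum_right sum_distrib_left)
qed

lemma ergodic_mean_linear:
  assumes "linear h"
  shows "h (ergodic_mean u N) = ergodic_mean (\<lambda>k. h (u k)) N"
  using assms by (simp add: ergodic_mean_def linear_scale linear_sum)

lemma ergodic_mean_add: "ergodic_mean (\<lambda>k. u k + v k) N = ergodic_mean u N + ergodic_mean v N"
  by (simp add: ergodic_mean_def sum.distrib scaleR_add_right)

lemma ergodic_mean_diff: "ergodic_mean (\<lambda>k. u k - v k) N = ergodic_mean u N - ergodic_mean v N"
  by (simp add: ergodic_mean_def sum_subtractf scaleR_diff_right)

lemma ergodic_mean_const: "ergodic_mean (\<lambda>k. c) N = c"
proof -
  have "(\<Sum>k=0..N. c) = real (N + 1) *\<^sub>R c"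
    by (simp only: sum_constant_scaleR) simp
  then show ?thesis
    by (simp add: ergodic_mean_def)
qed

lemma ergodic_mean_telescope_le:
  fixes V :: "nat \<Rightarrow> real"
  assumes "\<And>k. u (Suc k) \<le> V k - V (Suc k)" and "\<And>k. 0 \<le> V k"
  shows "ergodic_mean u N \<le> V 0 / real (N + 1)"
proof -
  have "(\<Sum>k=0..N. u (Suc k)) \<le> (\<Sum>k=0..N. V k - V (Suc k))"
    by (intro sum_mono assms(1))
  also have "\<dots> = V 0 - V (Suc N)"
    using sum_telescope[of V N] by (simp add: atMost_atLeast0)
  also have "\<dots> \<le> V 0"
    using assms(2) by simp
  finally show ?thesis
    by (simp add: ergodic_mean_def divide_right_mono)
qed

text \<open>The subgradient inequality at \<open>xs\<close> and the convexity of \<open>g\<close> turn the first-order optimality conditions into the statement that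
  \<open>(xs, ys)\<close> minimizes the Lagrangian with multiplier \<open>ls\<close> over \<open>X \<times> Y\<close>.\<close>

lemma lagrange_multiplier_lower_bound:
  fixes A :: "real^'n^'m" and B :: "real^'p^'m"
  assumes g: "convex_on UNIV g" "g differentiable (at ys)"
    and opt: "primal_dual_optimal f g A B b X Y xs ys ls"
    and z: "z \<in> X" "v \<in> Y"
  shows "ls \<bullet> (A *v z + B *v v - b) \<le> f z + g v - f xs - g ys"
proof -
  obtain \<theta> where \<theta>: "f xs + \<theta> \<bullet> (z - xs) \<le> f z" "0 \<le> (z - xs) \<bullet> (\<theta> - transpose A *v ls)"
    using opt z by (auto simp: primal_dual_optimal_def subdifferential_def)
  have y: "0 \<le> (v - ys) \<bullet> (gradient g ys - transpose B *v ls)"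
    and feasible: "A *v xs + B *v ys = b"
    using opt z by (auto simp: primal_dual_optimal_def)
  have "g ys + (v - ys) \<bullet> gradient g ys \<le> g v"
    by (intro convex_on_ge_tangent g GDERIV_gradient)
  moreover have "ls \<bullet> (A *v z + B *v v - b)
      = (transpose A *v ls) \<bullet> (z - xs) + (transpose B *v ls) \<bullet> (v - ys)"
    unfolding feasible[symmetric] inner_transpose_mult
    by (simp add: inner_diff_right inner_add_right matrix_vector_mult_diff_distrib)
  ultimately show ?thesis
    using \<theta> y by (simp add: inner_diff_right[of "z - xs"] inner_diff_right[of "v - ys"] inner_commute
        del: transpose_matrix_vector)
qed

text \<open>How a Lagrangian gap \<open>\<delta> - \<langle>\<nu>, r\<rangle>\<close> that is controlled for every multiplier \<open>\<nu>\<close> bounds the residual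
  \<open>r\<close> and the objective gap \<open>\<delta>\<close> separately: for \<open>\<nu> = ls - r / \<parallel>r\<parallel>\<close> the gap is
  \<open>(\<delta> - \<langle>ls, r\<rangle>) + \<parallel>r\<parallel>\<close>, whose first summand is nonnegative.\<close>

lemma bounds_from_shifted_multiplier:
  fixes r ls l0 :: "'a::real_inner"
  assumes lower: "ls \<bullet> r \<le> \<delta>"
    and upper: "\<And>\<nu>. \<delta> - \<nu> \<bullet> r \<le> (\<alpha> + \<beta> * (norm (l0 - \<nu>))\<^sup>2) / n"
    and "0 \<le> \<beta>" "0 < n"
    and C_eq: "C = \<alpha> + \<beta> * (norm (l0 - ls) + 1)\<^sup>2"
  shows "norm r \<le> C / n" and "\<bar>\<delta>\<bar> \<le> (norm ls + 1) * C / n"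
proof -
  \<comment> \<open>The value \<open>sgn 0 = 0\<close> covers a vanishing residual.\<close>
  define e where "e = sgn r"
  have e: "e \<bullet> r = norm r"
    by (cases "r = 0")
      (simp_all add: e_def sgn_div_norm dot_square_norm power2_eq_square)
  have "norm (l0 - ls + e) \<le> norm (l0 - ls) + 1"
    using norm_triangle_ineq[of "l0 - ls" e] by (simp add: e_def norm_sgn split: if_splits)
  then have C: "(\<alpha> + \<beta> * (norm (l0 - (ls - e)))\<^sup>2) / n \<le> C / n"
    using assms(3,4) unfolding C_eq
    by (intro divide_right_mono add_left_mono mult_left_mono power_mono) (auto simp: algebra_simps)
  have "\<delta> - ls \<bullet> r + norm r \<le> C / n"
    using upper[of "ls - e"] C by (simp add: inner_diff_left e)
  with lower show r: "norm r \<le> C / n"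
    by linarith
  have ls: "\<bar>ls \<bullet> r\<bar> \<le> norm ls * (C / n)"
    using Cauchy_Schwarz_ineq2[of ls r] mult_left_mono[OF r, of "norm ls"] by simp
  have "\<delta> \<le> ls \<bullet> r + C / n"
    using \<open>\<delta> - ls \<bullet> r + norm r \<le> C / n\<close> norm_ge_zero[of r] by linarith
  moreover have "0 \<le> C / n"
    using r norm_ge_zero order_trans by blast
  ultimately have "\<bar>\<delta>\<bar> \<le> norm ls * (C / n) + C / n"
    using lower ls by linarith
  then show "\<bar>\<delta>\<bar> \<le> (norm ls + 1) * C / n"
    by (simp add: algebra_simps add_divide_distrib)
qed

theorem theorem3p4:
  fixes f :: "real^'n::{finite,linorder} \<Rightarrow> real"
    and g :: "real^'p \<Rightarrow> real"
    and A :: "real^'n::{finite,linorder}^'m::{finite,linorder}"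
    and B :: "real^'p^'m::{finite,linorder}"
    and b :: "real^'m::{finite,linorder}"
    and X :: "(real^'n::{finite,linorder}) set"
    and Y :: "(real^'p) set"
    and H :: "real^'n::{finite,linorder}^'n::{finite,linorder}"
    and \<gamma> \<tau> Lg :: real
    and x :: "nat \<Rightarrow> real^'n::{finite,linorder}"
    and y yb :: "nat \<Rightarrow> real^'p"
    and l lb :: "nat \<Rightarrow> real^'m::{finite,linorder}"
    and xs :: "real^'n::{finite,linorder}"
    and ys :: "real^'p"
    and ls :: "real^'m::{finite,linorder}"
  assumes "convex_on UNIV f"
    and "convex_on UNIV g"
    and "\<forall>v. g differentiable (at v)"
    and "X \<noteq> {}" "closed X" "convex X"
    and "Y \<noteq> {}" "closed Y" "convex Y"
    and "Lg-lipschitz_on Y (gradient g)"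
    and "\<gamma> > 0"
    and "L_hat Lg B \<noteq> 0 \<longrightarrow> \<gamma> \<le> 1 / (2 * L_hat Lg B)"
    and "is_identity_matrix A \<longrightarrow> H = 0"
    and "\<not> is_identity_matrix A \<longrightarrow>
           \<tau> > \<gamma> * lambda_max (transpose A ** A) \<and>
           H = \<tau> *\<^sub>R mat 1 - \<gamma> *\<^sub>R (transpose A ** A)"
    and "egadm_iterates f g A B b X Y \<gamma> H x y yb l lb"
    and "primal_dual_optimal f g A B b X Y xs ys ls"
  shows "\<exists>K\<ge>0. \<forall>N>0.
           \<bar>f (ergodic_mean x N) + g (ergodic_mean yb N) - f xs - g ys\<bar> \<le> K / real N \<and>
           norm (A *v ergodic_mean x N + B *v ergodic_mean yb N - b) \<le> K / real N"
proof -
  note f = assms(1) and g = assms(2) and dg = assms(3) and \<gamma> = \<open>\<gamma> > 0\<close>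
    and it = \<open>egadm_iterates f g A B b X Y \<gamma> H x y yb l lb\<close>
    and opt = \<open>primal_dual_optimal f g A B b X Y xs ys ls\<close>
  have H: "transpose H = H" "0 \<le> sqnorm_wrt H v" for v
  proof -
    have "transpose H = H \<and> 0 \<le> sqnorm_wrt H v"
    proof (cases "is_identity_matrix A")
      case True
      then show ?thesis
        using assms(13) by (simp add: sqnorm_wrt_def transpose_mat[of 0, simplified mat_0])
    next
      case False
      let ?G = "transpose A ** A"
      have \<tau>: "\<gamma> * lambda_max ?G < \<tau>" and H: "H = \<tau> *\<^sub>R mat 1 - \<gamma> *\<^sub>R ?G"
        using assms(14) False by auto
      have "\<gamma> * (v \<bullet> (?G *v v)) \<le> \<gamma> * (lambda_max ?G * (norm v)\<^sup>2)"
        using \<gamma> quadratic_form_le_lambda_max[OF symmetric_gram, of v A] by (intro mult_left_mono) auto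
      also have "\<dots> \<le> \<tau> * (norm v)\<^sup>2"
        using mult_right_mono[OF less_imp_le[OF \<tau>], of "(norm v)\<^sup>2"] by (simp add: mult_ac)
      finally have "0 \<le> sqnorm_wrt H v"
        by (simp add: H sqnorm_wrt_def matrix_vector_mult_diff_rdistrib inner_diff_right
            power2_norm_eq_inner flip: scaleR_matrix_vector_assoc)
      moreover have "transpose H = H"
        using symmetric_gram[of A]
        by (simp add: H transpose_def vec_eq_iff mat_def)
      ultimately show ?thesis
        by blast
    qed
    then show "transpose H = H" "0 \<le> sqnorm_wrt H v"
      by auto
  qed
  have step_size: "\<gamma> * L_hat Lg B \<le> 1"
  proof (cases "L_hat Lg B = 0")
    case False
    then have "0 < L_hat Lg B" "\<gamma> \<le> 1 / (2 * L_hat Lg B)"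
      using L_hat_nonneg[of Lg B] assms(12) by auto
    then show ?thesis
      by (simp add: field_simps)
  qed simp
  have xs: "xs \<in> X" "ys \<in> Y" "A *v xs + B *v ys = b"
    using opt by (auto simp: primal_dual_optimal_def)
  define V where "V \<nu> k = egadm_potential \<gamma> H xs ys \<nu> (x k) (y k) (l k)" for \<nu> k
  define \<delta> where "\<delta> N = f (ergodic_mean x N) + g (ergodic_mean yb N) - f xs - g ys" for N
  define r where "r N = A *v ergodic_mean x N + B *v ergodic_mean yb N - b" for N
  \<comment> \<open>The part of the initial potential that does not depend on the multiplier.\<close>
  define \<alpha> where "\<alpha> = 1 / 2 * sqnorm_wrt H (x 0 - xs) + (norm (y 0 - ys))\<^sup>2 / (2 * \<gamma>)"
  define C where "C = \<alpha> + 1 / (2 * \<gamma>) * (norm (l 0 - ls) + 1)\<^sup>2"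

  have upper: "\<delta> N - \<nu> \<bullet> r N \<le> (\<alpha> + 1 / (2 * \<gamma>) * (norm (l 0 - \<nu>))\<^sup>2) / real (N + 1)" for \<nu> N
  proof -
    let ?r = "\<lambda>k. A *v x k + B *v yb k - b"
    let ?u = "\<lambda>k. f (x k) + g (yb k) - f xs - g ys - \<nu> \<bullet> ?r k"
    have "r N = ergodic_mean ?r N"
      by (simp add: r_def ergodic_mean_linear ergodic_mean_add ergodic_mean_diff ergodic_mean_const)
    then have "\<nu> \<bullet> r N = ergodic_mean (\<lambda>k. \<nu> \<bullet> ?r k) N"
      by (simp only: ergodic_mean_linear[of "(\<bullet>) \<nu>"] bounded_linear.linear[OF bounded_linear_inner_right])
    then have "\<delta> N - \<nu> \<bullet> r N \<le> ergodic_mean ?u N"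
      using convex_on_ergodic_mean[OF f, of x N] convex_on_ergodic_mean[OF g, of yb N]
      by (simp only: \<delta>_def ergodic_mean_add ergodic_mean_diff ergodic_mean_const)
    also have "\<dots> \<le> V \<nu> 0 / real (N + 1)"
    proof (rule ergodic_mean_telescope_le)
      show "?u (Suc k) \<le> V \<nu> k - V \<nu> (Suc k)" for k
        unfolding V_def
        by (rule egadm_potential_decrease[OF f g _ \<open>convex X\<close> xs(1) \<open>closed Y\<close> \<open>convex Y\<close> xs(2,3)
              assms(10) \<gamma> step_size H it]) (simp add: dg)
      show "0 \<le> V \<nu> k" for k
        using \<gamma> H(2) by (simp add: V_def egadm_potential_def)
    qed
    also have "V \<nu> 0 = \<alpha> + 1 / (2 * \<gamma>) * (norm (l 0 - \<nu>))\<^sup>2"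
      by (simp add: V_def egadm_potential_def \<alpha>_def add_divide_distrib)
    finally show ?thesis .
  qed
  have lower: "ls \<bullet> r N \<le> \<delta> N" for N
    unfolding r_def \<delta>_def using egadm_iterates_in[OF it \<open>closed Y\<close>] dg
    by (intro lagrange_multiplier_lower_bound[OF g _ opt] ergodic_mean_in_convex
        \<open>convex X\<close> \<open>convex Y\<close>) auto
  have C: "0 \<le> C"
    unfolding C_def \<alpha>_def using \<gamma> H(2) by (intro add_nonneg_nonneg mult_nonneg_nonneg) auto
  define K where "K = (norm ls + 1) * C"
  have K: "0 \<le> K" "C \<le> K"
    using C by (auto simp: K_def algebra_simps)
  show ?thesis
  proof (intro exI[of _ K] conjI allI impI)
    fix N :: nat
    assume N: "N > 0"
    have b: "norm (r N) \<le> C / real (N + 1)" "\<bar>\<delta> N\<bar> \<le> K / real (N + 1)"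
      unfolding K_def using \<gamma>
      by (intro bounds_from_shifted_multiplier[OF lower upper _ _ C_def]; simp)+
    have "C / real (N + 1) \<le> K / real N" "K / real (N + 1) \<le> K / real N"
      using N K C by (auto intro!: frac_le)
    with b show "\<bar>f (ergodic_mean x N) + g (ergodic_mean yb N) - f xs - g ys\<bar> \<le> K / real N"
      and "norm (A *v ergodic_mean x N + B *v ergodic_mean yb N - b) \<le> K / real N"
      by (auto simp: r_def \<delta>_def)
  qed (rule K)
qed

end
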